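(* Let $n,k$ be natural numbers with $1\le k\le n$ and $n+1\le 2k$. Let $$\mathbf a=(a_0,\dots,a_{n-k},0,\dots,0),\quad \mathbf b=(b_0,\dots,b_n),\quad \mathbf c=(c_0,\dots,c_{n-k},0,\dots,0)$$ be vectors in $\mathbb C^{n+1}$, and let $A$ be the $(n+1)\times(n+1)$ complex $k$-tridiagonal matrix $$A=N^{-k}D(\mathbf a)+D(\mathbf b)+D(\mathbf c)N^{k}.$$ (j) $A$ is nonsingular if and only if $$b_j\ne 0\quad (j=n+1-k,\dots,k-1)\qquad\text{and}\qquad b_jb_{j+k}-a_jc_j\ne 0\quad (j=0,\dots,n-k).$$ (jj) If the conditions in (j) hold, then $A^{-1}$ is also $k$-tridiagonal and is of the form $$A^{-1}=N^{-k}D(\mathbf x)+D(\mathbf y)+D(\mathbf z)N^{k},$$ where $$\mathbf x=\left(\frac{-a_0}{b_0b_k-a_0c_0},\dots,\frac{-a_{n-k}}{b_{n-k}b_n-a_{n-k}c_{n-k}},0,\dots,0\right),$$ $$\mathbf y=\left(\frac{b_k}{b_0b_k-a_0c_0},\dots,\frac{b_n}{b_{n-k}b_n-a_{n-k}c_{n-k}},\frac1{b_{n+1-k}},\dots,\frac1{b_{k-1}},\frac{b_0}{b_kb_0-a_0c_0},\dots,\frac{b_{n-k}}{b_nb_{n-k}-a_{n-k}c_{n-k}}\right),$$ $$\mathbf z=\left(\frac{-c_0}{b_0b_k-a_0c_0},\dots,\frac{-c_{n-k}}{b_{n-k}b_n-a_{n-k}c_{n-k}},0,\dots,0\right).$$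 That is, for $0\le j\le n-k$: $x_j=\frac{-a_j}{b_jb_{j+k}-a_jc_j}$, $z_j=\frac{-c_j}{b_jb_{j+k}-a_jc_j}$, $y_j=\frac{b_{j+k}}{b_jb_{j+k}-a_jc_j}$, $y_{j+k}=\frac{b_j}{b_jb_{j+k}-a_jc_j}$; for $n+1-k\le j\le k-1$: $y_j=\frac1{b_j}$; and $x_j=z_j=0$ for $n-k<j\le n$.
   Context: Rows and columns of matrices, and coordinates of vectors, are indexed by $0,1,\dots,n$. For $\mathbf v=(v_0,\dots,v_n)\in\mathbb C^{n+1}$, $D(\mathbf v)=\mathrm{Diag}(v_0,\dots,v_n)$ is the $(n+1)\times(n+1)$ diagonal matrix with diagonal $\mathbf v$. $N=(n_{ij})_{i,j=0}^n$ is the nilpotent matrix with $n_{ij}=1$ if $j-i=1$ and $n_{ij}=0$ otherwise; for a positive integer $k$, $N^{-k}$ denotes, by definition, $(N^T)^k$ (not an inverse). Thus $N^k$ has ones exactly at the positions $(i,i+k)$ and $N^{-k}$ has ones exactly at the positions $(i+k,i)$, so the matrix $A=N^{-k}D(\mathbf a)+D(\mathbf b)+D(\mathbf c)N^k$ has entries $A_{i,i}=b_i$ for $0\le i\le n$, $A_{i+k,i}=a_i$ and $A_{i,i+k}=c_i$ for $0\le i\le n-k$, and all other entries zero. A matrix $(m_{ij})_{i,j=0}^n$ is called $k$-tridiagonal if $m_{ij}=0$ whenever $|i-j|\notin\{0,k\}$. When $n+1=2k$, the index range $j=n+1-k,\dots,k-1$ is empty. *)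

theory Defs
  imports Complex_Main "Jordan_Normal_Form.Matrix"
begin

definition D :: "complex vec \<Rightarrow> complex mat" where
  "D v = mat_diag (dim_vec v) (\<lambda>i. v $ i)"

text \<open>The argument \<open>n\<close> is the largest index: indices run over \<open>0, \<dots>, n\<close>, so the size is \<open>n + 1\<close>.\<close>

definition N :: "nat \<Rightarrow> complex mat" where
  "N n = mat (n + 1) (n + 1) (\<lambda>(i, j). if j = i + 1 then 1 else 0)"

text \<open>The factor \<open>(N n)\<^sup>T ^\<^sub>m k\<close> is what is conventionally written \<open>N\<close> to the power \<open>-k\<close>;
  it is not an inverse.\<close>

definition tridiag :: "nat \<Rightarrow> nat \<Rightarrow> complex vec \<Rightarrow> complex vec \<Rightarrow> complex vec \<Rightarrow> complex mat" where
  "tridiag n k a b c = ((N n)\<^sup>T ^\<^sub>m k) * D a + D b + D c * (N n ^\<^sub>m k)"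

definition k_tridiagonal :: "nat \<Rightarrow> nat \<Rightarrow> complex mat \<Rightarrow> bool" where
  "k_tridiagonal n k M \<longleftrightarrow> M \<in> carrier_mat (n + 1) (n + 1) \<and>
     (\<forall>i\<le>n. \<forall>j\<le>n. \<bar>int i - int j\<bar> \<notin> {0, int k} \<longrightarrow> M $$ (i, j) = 0)"

lemma N_carrier [simp]: "N n \<in> carrier_mat (n + 1) (n + 1)"
  by (simp add: N_def)

lemma N_pow: "N n ^\<^sub>m k = mat (n + 1) (n + 1) (\<lambda>(i, j). if j = i + k then 1 else 0)"
proof (induction k)
  case 0
  show ?case by (rule eq_matI) (auto simp: N_def)
next
  case (Suc k)
  show ?case
    unfolding pow_mat.simps Suc.IH
  proof (rule eq_matI)
    fix i j
    assume "i < dim_row (mat (n + 1) (n + 1) (\<lambda>(i, j). if j = i + Suc k then 1 else 0 :: complex))"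
      and "j < dim_col (mat (n + 1) (n + 1) (\<lambda>(i, j). if j = i + Suc k then 1 else 0 :: complex))"
    then have ij: "i < n + 1" "j < n + 1" by auto
    have "(mat (n + 1) (n + 1) (\<lambda>(i, j). if j = i + k then 1 else 0) * N n) $$ (i, j)
        = (\<Sum>l\<in>{0..<n + 1}. (if l = i + k then 1 else 0) * (if j = l + 1 then 1 else 0))"
      using ij by (simp add: N_def scalar_prod_def)
    also have "\<dots> = (\<Sum>l\<in>{0..<n + 1}. if l = i + k then (if j = i + k + 1 then 1 else 0) else 0)"
      by (rule sum.cong) auto
    also have "\<dots> = (if j = i + Suc k then 1 else 0)"
      using ij by (subst sum.delta) auto
    finally show "(mat (n + 1) (n + 1) (\<lambda>(i, j). if j = i + k then 1 else 0) * N n) $$ (i, j)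
        = mat (n + 1) (n + 1) (\<lambda>(i, j). if j = i + Suc k then 1 else 0) $$ (i, j)"
      using ij by simp
  qed (simp_all add: N_def)
qed

lemma N_transpose_pow:
  "(N n)\<^sup>T ^\<^sub>m k = mat (n + 1) (n + 1) (\<lambda>(i, j). if i = j + k then 1 else 0)"
proof (induction k)
  case 0
  show ?case by (rule eq_matI) (auto simp: N_def)
next
  case (Suc k)
  show ?case
    unfolding pow_mat.simps Suc.IH
  proof (rule eq_matI)
    fix i j
    assume "i < dim_row (mat (n + 1) (n + 1) (\<lambda>(i, j). if i = j + Suc k then 1 else 0 :: complex))"
      and "j < dim_col (mat (n + 1) (n + 1) (\<lambda>(i, j). if i = j + Suc k then 1 else 0 :: complex))"
    then have ij: "i < n + 1" "j < n + 1" by auto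
    have "(mat (n + 1) (n + 1) (\<lambda>(i, j). if i = j + k then 1 else 0) * (N n)\<^sup>T) $$ (i, j)
        = (\<Sum>l\<in>{0..<n + 1}. (if i = l + k then 1 else 0) * (if l = j + 1 then 1 else 0))"
      using ij by (simp add: N_def scalar_prod_def)
    also have "\<dots> = (\<Sum>l\<in>{0..<n + 1}. if l = j + 1 then (if i = j + 1 + k then 1 else 0) else 0)"
      by (rule sum.cong) auto
    also have "\<dots> = (if i = j + Suc k then 1 else 0)"
      using ij by (subst sum.delta) auto
    finally show "(mat (n + 1) (n + 1) (\<lambda>(i, j). if i = j + k then 1 else 0) * (N n)\<^sup>T) $$ (i, j)
        = mat (n + 1) (n + 1) (\<lambda>(i, j). if i = j + Suc k then 1 else 0) $$ (i, j)"
      using ij by simp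
  qed (simp_all add: N_def)
qed

lemma tridiag_eq_mat:
  assumes "a \<in> carrier_vec (n + 1)" "b \<in> carrier_vec (n + 1)" "c \<in> carrier_vec (n + 1)" "1 \<le> k"
  shows "tridiag n k a b c = mat (n + 1) (n + 1) (\<lambda>(i, j).
    if i = j then b $ i else if i = j + k then a $ j else if j = i + k then c $ i else 0)"
proof -
  have dims: "dim_vec a = n + 1" "dim_vec b = n + 1" "dim_vec c = n + 1"
    using assms by auto
  show ?thesis
    unfolding tridiag_def D_def dims N_pow N_transpose_pow
    using assms(4)
    by (subst mat_diag_mult_left[of _ _ "n + 1"], simp,
        subst mat_diag_mult_right[of _ "n + 1"], simp,
        intro eq_matI) (auto simp: mat_diag_def)
qed

lemma k_tridiagonal_tridiag:
  assumes "a \<in> carrier_vec (n + 1)" "b \<in> carrier_vec (n + 1)" "c \<in> carrier_vec (n + 1)" "1 \<le> k"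
  shows "k_tridiagonal n k (tridiag n k a b c)"
  unfolding k_tridiagonal_def tridiag_eq_mat[OF assms] by auto

end

theory Submission
  imports Defs "Jordan_Normal_Form.Determinant"
begin

text \<open>Since \<open>n + 1 \<le> 2k\<close>, every index has at most one partner at distance \<open>k\<close>, so up to a
  permutation of the indices \<open>A\<close> is block diagonal: \<open>1 \<times> 1\<close> blocks \<open>b\<^sub>j\<close> for the unpaired indices
  \<open>n + 1 - k \<le> j \<le> k - 1\<close>, and \<open>2 \<times> 2\<close> blocks with rows \<open>(b\<^sub>j, c\<^sub>j)\<close> and \<open>(a\<^sub>j, b\<^bsub>j+k\<^esub>)\<close> for the
  pairs \<open>{j, j + k}\<close>, \<open>j \<le> n - k\<close>. It is inverted block by block.\<close>

lemma tridiag_carrier: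
  assumes "a \<in> carrier_vec (n + 1)" "b \<in> carrier_vec (n + 1)" "c \<in> carrier_vec (n + 1)" "1 \<le> k"
  shows "tridiag n k a b c \<in> carrier_mat (n + 1) (n + 1)"
  using k_tridiagonal_tridiag[OF assms] by (simp add: k_tridiagonal_def)

lemma tridiag_index:
  assumes "a \<in> carrier_vec (n + 1)" "b \<in> carrier_vec (n + 1)" "c \<in> carrier_vec (n + 1)" "1 \<le> k"
    and "i \<le> n" "j \<le> n"
  shows "tridiag n k a b c $$ (i, j) =
    (if i = j then b $ i else if i = j + k then a $ j else if j = i + k then c $ i else 0)"
  using assms by (simp add: tridiag_eq_mat)

text \<open>Row \<open>i\<close> is supported on columns \<open>i\<close>, \<open>i + k\<close> and
  \<open>i - k\<close>. When \<open>n + 1 \<le> 2 * k\<close>, at most one of the two guards is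
  true, which leaves at most two terms.\<close>

lemma tridiag_mult_index:
  assumes "a \<in> carrier_vec (n + 1)" "b \<in> carrier_vec (n + 1)" "c \<in> carrier_vec (n + 1)" "1 \<le> k"
    and M: "M \<in> carrier_mat (n + 1) m" and i: "i \<le> n" and j: "j < m"
  shows "(tridiag n k a b c * M) $$ (i, j) = b $ i * M $$ (i, j)
    + (if i + k \<le> n then c $ i * M $$ (i + k, j) else 0)
    + (if k \<le> i then a $ (i - k) * M $$ (i - k, j) else 0)"
proof -
  note T = tridiag_carrier[OF assms(1-4)]
  have "(tridiag n k a b c * M) $$ (i, j)
      = (\<Sum>l\<in>{0..<n + 1}. tridiag n k a b c $$ (i, l) * M $$ (l, j))"
    using T M i j by (simp add: scalar_prod_def)
  \<comment> \<open>The guard \<open>k \<le> i\<close> is essential: truncated subtraction would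
    otherwise turn \<open>i - k\<close> into the valid column 0.\<close>
  also have "\<dots> = (\<Sum>l\<in>{0..<n + 1}. (if l = i then b $ i * M $$ (i, j) else 0)
      + (if l = i + k then c $ i * M $$ (i + k, j) else 0)
      + (if k \<le> i \<and> l = i - k then a $ (i - k) * M $$ (i - k, j) else 0))"
    using assms(4) i by (intro sum.cong refl) (auto simp: tridiag_index[OF assms(1-4)])
  also have "\<dots> = b $ i * M $$ (i, j)
    + (if i + k \<le> n then c $ i * M $$ (i + k, j) else 0)
    + (if k \<le> i then a $ (i - k) * M $$ (i - k, j) else 0)"
    using i by (cases "k \<le> i") (auto simp: sum.distrib sum.delta simp del: sum.op_ivl_Suc)
  finally show ?thesis .
qed

theorem theorem2:
  fixes n k :: nat
    and a b c x y z :: "complex vec"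
    and A :: "complex mat"
  assumes "1 \<le> k" and "k \<le> n" and "n + 1 \<le> 2 * k"
    and "a \<in> carrier_vec (n + 1)" and "b \<in> carrier_vec (n + 1)" and "c \<in> carrier_vec (n + 1)"
    and "\<forall>j\<in>{n - k<..n}. a $ j = 0" and "\<forall>j\<in>{n - k<..n}. c $ j = 0"
    and "A = tridiag n k a b c"
    and "x = vec (n + 1) (\<lambda>j. if j \<le> n - k then - (a $ j) / (b $ j * b $ (j + k) - a $ j * c $ j) else 0)"
    and "y = vec (n + 1) (\<lambda>j.
           if j \<le> n - k then b $ (j + k) / (b $ j * b $ (j + k) - a $ j * c $ j)
           else if j \<le> k - 1 then 1 / b $ j
           else b $ (j - k) / (b $ j * b $ (j - k) - a $ (j - k) * c $ (j - k)))"
    and "z = vec (n + 1) (\<lambda>j. if j \<le> n - k then - (c $ j) / (b $ j * b $ (j + k) - a $ j * c $ j) else 0)"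
  shows "(invertible_mat A \<longleftrightarrow>
            (\<forall>j\<in>{n + 1 - k..k - 1}. b $ j \<noteq> 0) \<and>
            (\<forall>j\<in>{0..n - k}. b $ j * b $ (j + k) - a $ j * c $ j \<noteq> 0)) \<and>
         ((\<forall>j\<in>{n + 1 - k..k - 1}. b $ j \<noteq> 0) \<and>
          (\<forall>j\<in>{0..n - k}. b $ j * b $ (j + k) - a $ j * c $ j \<noteq> 0) \<longrightarrow>
            inverts_mat A (tridiag n k x y z) \<and> inverts_mat (tridiag n k x y z) A \<and>
            k_tridiagonal n k (tridiag n k x y z))"
proof -
  note car = assms(4-6)
  note A = tridiag_carrier[OF car assms(1), folded assms(9)]
  note mult = tridiag_mult_index[OF car assms(1), folded assms(9)]
  let ?B = "tridiag n k x y z"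
  let ?P = "(\<forall>j\<in>{n + 1 - k..k - 1}. b $ j \<noteq> 0) \<and>
            (\<forall>j\<in>{0..n - k}. b $ j * b $ (j + k) - a $ j * c $ j \<noteq> 0)"
  have xyz: "x \<in> carrier_vec (n + 1)" "y \<in> carrier_vec (n + 1)" "z \<in> carrier_vec (n + 1)"
    by (simp_all add: assms(10-12))
  note B = tridiag_carrier[OF xyz assms(1)]
  have inverse: "inverts_mat A ?B \<and> inverts_mat ?B A" if P: ?P
  proof -
    have "(A * ?B) $$ (i, j) = 1\<^sub>m (n + 1) $$ (i, j)" if ij: "i \<le> n" "j \<le> n" for i j
    proof -
      \<comment> \<open>The first index of a pair, an unpaired index, and the second index of a
        pair.\<close>
      consider (low) "i \<le> n - k" | (mid) "n - k < i" "i < k" | (high) "k \<le> i" by linarith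
      then show ?thesis
      proof cases
        case low
        define d where "d = b $ i * b $ (i + k) - a $ i * c $ i"
        have "d \<noteq> 0" using P low by (simp add: d_def)
        \<comment> \<open>From \<open>n - k < k\<close>: row \<open>i\<close> of \<open>A\<close>
          has no entry to the left at distance \<open>k\<close>, and \<open>y $ (i + k)\<close>
          falls under the third branch of \<open>y\<close>, whose denominator is \<open>d\<close> up
          to commutativity.\<close>
        have ik: "i + k \<le> n" "i < k" "\<not> i + k \<le> n - k" "\<not> i + k \<le> k - 1"
          using low assms(1-3) by auto
        have v: "x $ i = - (a $ i) / d" "y $ i = b $ (i + k) / d" "z $ i = - (c $ i) / d"
          "y $ (i + k) = b $ i / d"
          using low ik ij by (simp_all add: assms(10-12) d_def mult.commute)
        \<comment> \<open>\<open>one\<close> and \<open>zero\<close> multiply the first row of the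
          \<open>2 \<times> 2\<close> block by its inverse, the adjugate divided by the determinant
          \<open>d\<close>.\<close>
        have one: "b $ i * y $ i + c $ i * x $ i = 1"
          using \<open>d \<noteq> 0\<close> d_def by (simp add: v divide_simps)
        have zero: "b $ i * z $ i + c $ i * y $ (i + k) = 0"
          by (simp add: v)
        have "(A * ?B) $$ (i, j) = b $ i * ?B $$ (i, j) + c $ i * ?B $$ (i + k, j)"
          using mult[OF B, of i j] ij ik by simp
        also have "\<dots> = (if i = j then b $ i * y $ i + c $ i * x $ i else
            if j = i + k then b $ i * z $ i + c $ i * y $ (i + k) else 0)"
          using ij ik assms(1) by (auto simp: tridiag_index[OF xyz assms(1)])
        also have "\<dots> = (if i = j then 1 else 0)"
          using one zero assms(1) by auto
        finally show ?thesis using ij by simp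
      next
        case mid
        \<comment> \<open>Both neighbours at distance \<open>k\<close> are out of range, so the row
          contains only \<open>b $ i\<close>.\<close>
        have "i \<in> {n + 1 - k..k - 1}" using mid assms(2) by auto
        then have "b $ i \<noteq> 0" using P by blast
        moreover have "y $ i = 1 / b $ i" using mid \<open>i \<in> _\<close> ij by (simp add: assms(11))
        ultimately show ?thesis
          using mult[OF B, of i j] ij mid by (auto simp: tridiag_index[OF xyz assms(1)])
      next
        case high
        \<comment> \<open>\<open>l\<close> is the partner of \<open>i\<close>; this case treats the
          second row of the block of \<open>l\<close> and \<open>l + k\<close>.\<close>
        define l where "l = i - k"
        define d where "d = b $ l * b $ (l + k) - a $ l * c $ l"
        have l: "i = l + k" "l \<le> n - k" "l < k" "\<not> i + k \<le> n" "\<not> i \<le> n - k"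
          "\<not> i \<le> k - 1"
          using high ij assms(1-3) by (auto simp: l_def)
        have "d \<noteq> 0" using P l by (simp add: d_def)
        have v: "x $ l = - (a $ l) / d" "y $ l = b $ (l + k) / d" "z $ l = - (c $ l) / d"
          "y $ (l + k) = b $ l / d"
          using l ij by (simp_all add: assms(10-12) d_def mult.commute)
        have one: "b $ (l + k) * y $ (l + k) + a $ l * z $ l = 1"
          using \<open>d \<noteq> 0\<close> d_def by (simp add: v divide_simps)
        have zero: "b $ (l + k) * x $ l + a $ l * y $ l = 0"
          by (simp add: v)
        have "(A * ?B) $$ (i, j) = b $ i * ?B $$ (i, j) + a $ l * ?B $$ (l, j)"
          using mult[OF B, of i j] ij l by simp
        also have "\<dots> = (if l = j then b $ (l + k) * x $ l + a $ l * y $ l else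
            if i = j then b $ (l + k) * y $ (l + k) + a $ l * z $ l else 0)"
          using ij l assms(1) by (auto simp: tridiag_index[OF xyz assms(1)])
        also have "\<dots> = (if i = j then 1 else 0)"
          using one zero l(1) assms(1) by auto
        finally show ?thesis using ij by simp
      qed
    qed
    then have AB: "A * ?B = 1\<^sub>m (n + 1)"
      using A B by (intro eq_matI) auto
    moreover have "?B * A = 1\<^sub>m (n + 1)"
      \<comment> \<open>For square matrices over a field a right inverse is also a left
        inverse.\<close>
      using mat_mult_left_right_inverse[OF A B AB] .
    ultimately show ?thesis using A B by (simp add: inverts_mat_def)
  qed
  have nonsingular: ?P if inv: "invertible_mat A"
  proof -
    obtain M where M1: "A * M = 1\<^sub>m (n + 1)" and M2: "M * A = 1\<^sub>m (dim_row M)"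
      using inv A by (auto simp: invertible_mat_def inverts_mat_def)
    \<comment> \<open>Comparing column counts in \<open>M1\<close> gives the width of
      \<open>M\<close>, and in \<open>M2\<close> its height.\<close>
    have M: "M \<in> carrier_mat (n + 1) (n + 1)"
      using arg_cong[OF M1, of dim_col] arg_cong[OF M2, of dim_col] A by auto
    have "b $ j \<noteq> 0" if "j \<in> {n + 1 - k..k - 1}" for j
    proof -
      have "j \<le> n" "\<not> j + k \<le> n" "\<not> k \<le> j" using that assms(1,2) by auto
      \<comment> \<open>This is the diagonal entry of \<open>A * M\<close> at an unpaired
        index.\<close>
      then have "b $ j * M $$ (j, j) = 1"
        using mult[OF M, of j j] by (simp add: M1)
      then show ?thesis by auto
    qed
    moreover have "b $ j * b $ (j + k) - a $ j * c $ j \<noteq> 0" if "j \<in> {0..n - k}" for j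
    proof -
      have j: "j + k \<le> n" "j < k" using that assms(1-3) by auto
      let ?m = "\<lambda>p q. M $$ (p, q)"
      \<comment> \<open>Rows \<open>j\<close> and \<open>j + k\<close> of \<open>A\<close> are
        supported on columns \<open>j\<close> and \<open>j + k\<close>, so restricting
        \<open>A * M\<close> to these indices is a product of \<open>2 \<times> 2\<close> blocks.
        The vanishing entry \<open>(j, j + k)\<close> cancels the product of the off-diagonal
        entries in the determinant.\<close>
      have rows: "b $ j * ?m j j + c $ j * ?m (j + k) j = 1"
        "b $ j * ?m j (j + k) + c $ j * ?m (j + k) (j + k) = 0"
        "b $ (j + k) * ?m (j + k) (j + k) + a $ j * ?m j (j + k) = 1"
        using mult[OF M, of j j] mult[OF M, of j "j + k"]
          mult[OF M, of "j + k" "j + k"] j assms(3) by (simp_all add: M1)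
      \<comment> \<open>multiplicativity of the \<open>2 \<times> 2\<close> determinant\<close>
      have "(b $ j * b $ (j + k) - a $ j * c $ j) *
          (?m j j * ?m (j + k) (j + k) - ?m j (j + k) * ?m (j + k) j) =
          (b $ j * ?m j j + c $ j * ?m (j + k) j) *
          (b $ (j + k) * ?m (j + k) (j + k) + a $ j * ?m j (j + k)) -
          (b $ j * ?m j (j + k) + c $ j * ?m (j + k) (j + k)) *
          (b $ (j + k) * ?m (j + k) j + a $ j * ?m j j)"
        by (simp add: algebra_simps)
      also have "\<dots> = 1"
        unfolding rows by simp
      finally show ?thesis by auto
    qed
    ultimately show ?thesis by blast
  qed
  have "invertible_mat A" if ?P
    using inverse[OF that] A by (auto simp: invertible_mat_def)
  then show ?thesis
    using nonsingular inverse k_tridiagonal_tridiag[OF xyz assms(1)] by blast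
qed

end
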